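(* Let $p\in M^3_{\mathrm{reg}}$ be a point in a generic 3-manifold $M^3_{\mathrm{reg}}\subset\mathbb{R}^6$ and suppose $\dim E_p=2$ (i.e. the curvature locus is a planar region). Then there exists a unique umbilical focus at $p$, given by $$a=p+\frac{1}{\kappa_u^6}v,$$ where $v$ is a unit vector in $E_p^\perp$.
   Context: For a smooth regular 3-manifold $M^3_{\mathrm{reg}}\subset\mathbb{R}^6$ with second fundamental form $II_p$ and 3-dimensional normal space $N_pM^3_{\mathrm{reg}}$ (origin $p$), the curvature locus at $p$ is $\{II_p(w,w):w\in T_pM^3_{\mathrm{reg}},|w|=1\}$; $\mathrm{Aff}_p$ is the smallest affine subspace of $N_pM^3_{\mathrm{reg}}$ containing it, $E_p$ is the vector subspace parallel to $\mathrm{Aff}_p$, and $E_p^\perp$ its orthogonal complement in $N_pM^3_{\mathrm{reg}}$. If $\dim E_p=2$, the umbilic curvature is $\kappa_u^6(p)=d(p,\mathrm{Aff}_p)$; equivalently, with $H=\frac13\sum_{i=1}^3II_p(e_i,e_i)$ the mean curvature vector ($\{e_i\}$ an orthonormal basis of $T_pM^3_{\mathrm{reg}}$) and $v$ the unit vector orthogonal to $E_p$ (oriented so that the product is non-negative), $\kappa_u^6(p)=\langle H,v\rangle$. For a generic 3-manifold, the rank of the second fundamental form (the dimension of the span of the image of $II_p$ in $N_pM^3_{\mathrm{reg}}$) is 3 at every point. For $a\in\mathbb{R}^6$, $d_a:M^3_{\mathrm{reg}}\to\mathbb{R}$ is $d_a(x)=\|x-a\|^2$. The focal set at $p$ is the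 set of $a$ for which $d_a$ has a degenerate singularity at $p$; an umbilical focus at $p$ is a point $a$ of the focal set at which $\operatorname{Hess}d_a(p)$ has corank 3. *)

theory Defs
  imports "HOL-Analysis.Analysis"
begin

section \<open>Smooth maps and regular 3-manifolds in \<open>\<real>\<^sup>6\<close>\<close>

abbreviation dir_deriv ::
  "('a::real_normed_vector \<Rightarrow> 'b::real_normed_vector) \<Rightarrow> 'a \<Rightarrow> 'a \<Rightarrow> 'b"
  where "dir_deriv f v x \<equiv> frechet_derivative f (at x) v"

primrec Ck_on ::
  "nat \<Rightarrow> 'a::real_normed_vector set \<Rightarrow> ('a \<Rightarrow> 'b::real_normed_vector) \<Rightarrow> bool"
  where
    "Ck_on 0 U f \<longleftrightarrow> continuous_on U f"
  | "Ck_on (Suc k) U f \<longleftrightarrow>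
       (\<forall>x\<in>U. f differentiable (at x)) \<and> (\<forall>v. Ck_on k U (dir_deriv f v))"

text \<open>Meaningful for open \<open>U\<close>, since the derivatives are taken with respect to the full filter
  \<open>at x\<close>.\<close>
definition smooth_on ::
  "'a::real_normed_vector set \<Rightarrow> ('a \<Rightarrow> 'b::real_normed_vector) \<Rightarrow> bool"
  where "smooth_on U f \<longleftrightarrow> (\<forall>k. Ck_on k U f)"

text \<open>A local parametrization of \<open>M\<close> around \<open>p = \<phi> x\<close>: a smooth immersion of an open set of
  \<open>\<real>\<^sup>3\<close> which is a homeomorphism onto a relatively open subset of \<open>M\<close>.\<close>
definition local_param ::
  "(real^6) set \<Rightarrow> real^6 \<Rightarrow> (real^3) set \<Rightarrow> (real^3 \<Rightarrow> real^6) \<Rightarrow> real^3 \<Rightarrow> bool"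
  where "local_param M p U \<phi> x \<longleftrightarrow>
    open U \<and> x \<in> U \<and> \<phi> x = p \<and> smooth_on U \<phi> \<and>
    (\<forall>y\<in>U. inj (frechet_derivative \<phi> (at y))) \<and>
    (\<exists>\<psi>. homeomorphism U (\<phi> ` U) \<phi> \<psi>) \<and>
    openin (top_of_set M) (\<phi> ` U)"

definition regular_3manifold :: "(real^6) set \<Rightarrow> bool"
  where "regular_3manifold M \<longleftrightarrow> (\<forall>p\<in>M. \<exists>U \<phi> x. local_param M p U \<phi> x)"

text \<open>The differential-geometric objects at \<open>p\<close> are computed in some local parametrization;
  none of them depends on which one is chosen.\<close>
definition chart_at :: "(real^6) set \<Rightarrow> real^6 \<Rightarrow> (real^3 \<Rightarrow> real^6) \<times> (real^3)"
  where "chart_at M p = (SOME (\<phi>, x). \<exists>U. local_param M p U \<phi> x)"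

abbreviation chart :: "(real^6) set \<Rightarrow> real^6 \<Rightarrow> real^3 \<Rightarrow> real^6"
  where "chart M p \<equiv> fst (chart_at M p)"

abbreviation base_point :: "(real^6) set \<Rightarrow> real^6 \<Rightarrow> real^3"
  where "base_point M p \<equiv> snd (chart_at M p)"

definition chart_deriv :: "(real^6) set \<Rightarrow> real^6 \<Rightarrow> real^3 \<Rightarrow> real^6"
  where "chart_deriv M p = frechet_derivative (chart M p) (at (base_point M p))"


section \<open>The second fundamental form and the curvature locus\<close>

text \<open>Tangent and normal spaces are vector subspaces of \<open>\<real>\<^sup>6\<close>: the vector \<open>0\<close> of
  \<open>normal_space M p\<close> plays the role of the origin \<open>p\<close>.\<close>
definition tangent_space :: "(real^6) set \<Rightarrow> real^6 \<Rightarrow> (real^6) set"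
  where "tangent_space M p = range (chart_deriv M p)"

definition normal_space :: "(real^6) set \<Rightarrow> real^6 \<Rightarrow> (real^6) set"
  where "normal_space M p = orthogonal_comp (tangent_space M p)"

definition normal_part :: "(real^6) set \<Rightarrow> real^6 \<Rightarrow> real^6 \<Rightarrow> real^6"
  where "normal_part M p z = (THE n. n \<in> normal_space M p \<and> z - n \<in> tangent_space M p)"

text \<open>For tangent vectors \<open>u = d\<phi> \<xi>\<close>, \<open>w = d\<phi> \<eta>\<close> this is the normal component of
  \<open>d\<^sup>2\<phi> (\<xi>, \<eta>)\<close>; the value is irrelevant if \<open>u\<close> or \<open>w\<close> is not tangent.\<close>
definition second_ff :: "(real^6) set \<Rightarrow> real^6 \<Rightarrow> real^6 \<Rightarrow> real^6 \<Rightarrow> real^6"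
  where "second_ff M p u w =
    (let \<xi> = inv (chart_deriv M p) u; \<eta> = inv (chart_deriv M p) w
     in normal_part M p
          (dir_deriv (dir_deriv (chart M p) \<eta>) \<xi> (base_point M p)))"

definition second_ff_rank :: "(real^6) set \<Rightarrow> real^6 \<Rightarrow> nat"
  where "second_ff_rank M p =
    dim (span {second_ff M p u w | u w. u \<in> tangent_space M p \<and> w \<in> tangent_space M p})"

definition curvature_locus :: "(real^6) set \<Rightarrow> real^6 \<Rightarrow> (real^6) set"
  where "curvature_locus M p =
    {second_ff M p w w | w. w \<in> tangent_space M p \<and> norm w = 1}"

definition Aff :: "(real^6) set \<Rightarrow> real^6 \<Rightarrow> (real^6) set"
  where "Aff M p = affine hull (curvature_locus M p)"

definition E_space :: "(real^6) set \<Rightarrow> real^6 \<Rightarrow> (real^6) set"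
  where "E_space M p = (THE L. subspace L \<and> affine_parallel (Aff M p) L)"

definition E_perp :: "(real^6) set \<Rightarrow> real^6 \<Rightarrow> (real^6) set"
  where "E_perp M p = normal_space M p \<inter> orthogonal_comp (E_space M p)"

text \<open>The distance from the origin \<open>p\<close> of the normal space to \<open>Aff M p\<close>.\<close>
definition umbilic_curvature :: "(real^6) set \<Rightarrow> real^6 \<Rightarrow> real"
  where "umbilic_curvature M p = infdist 0 (Aff M p)"

definition orthonormal_basis_of :: "(real^6) set \<Rightarrow> (real^6) set \<Rightarrow> bool"
  where "orthonormal_basis_of B S \<longleftrightarrow>
    pairwise orthogonal B \<and> (\<forall>b\<in>B. norm b = 1) \<and> span B = S"

text \<open>One third of the trace of the second fundamental form, which is the same for every
  orthonormal basis.\<close>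
definition mean_curvature :: "(real^6) set \<Rightarrow> real^6 \<Rightarrow> real^6"
  where "mean_curvature M p =
    (let B = (SOME B. orthonormal_basis_of B (tangent_space M p))
     in (1/3) *\<^sub>R (\<Sum>b\<in>B. second_ff M p b b))"


section \<open>Distance-squared functions and their singularities\<close>

definition dist_sq :: "real^6 \<Rightarrow> real^6 \<Rightarrow> real"
  where "dist_sq a x = (norm (x - a))\<^sup>2"

definition hessian :: "(real^3 \<Rightarrow> real) \<Rightarrow> real^3 \<Rightarrow> real^3^3"
  where "hessian g x = (\<chi> i j. dir_deriv (dir_deriv g (axis j 1)) (axis i 1) x)"

definition is_singular_at :: "(real^6) set \<Rightarrow> (real^6 \<Rightarrow> real) \<Rightarrow> real^6 \<Rightarrow> bool"
  where "is_singular_at M f p \<longleftrightarrow>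
    (\<forall>\<xi>. dir_deriv (f \<circ> chart M p) \<xi> (base_point M p) = 0)"

text \<open>The matrix of the Hessian of \<open>f\<close> restricted to \<open>M\<close> in the chosen chart. At a singular
  point of the restriction its rank is an invariant.\<close>
definition hess_on :: "(real^6) set \<Rightarrow> (real^6 \<Rightarrow> real) \<Rightarrow> real^6 \<Rightarrow> real^3^3"
  where "hess_on M f p = hessian (f \<circ> chart M p) (base_point M p)"

definition corank :: "real^'n^'n \<Rightarrow> nat"
  where "corank A = CARD('n) - rank A"

definition focal_set :: "(real^6) set \<Rightarrow> real^6 \<Rightarrow> (real^6) set"
  where "focal_set M p =
    {a. is_singular_at M (dist_sq a) p \<and> det (hess_on M (dist_sq a) p) = 0}"

definition umbilical_focus :: "(real^6) set \<Rightarrow> real^6 \<Rightarrow> real^6 \<Rightarrow> bool"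
  where "umbilical_focus M p a \<longleftrightarrow>
    a \<in> focal_set M p \<and> corank (hess_on M (dist_sq a) p) = 3"

text \<open>A unit vector of \<open>E_perp M p\<close> with the orientation for which
  \<open>umbilic_curvature M p = mean_curvature M p \<bullet> v\<close> (rather than its negative).\<close>
definition oriented_unit_normal :: "(real^6) set \<Rightarrow> real^6 \<Rightarrow> real^6 \<Rightarrow> bool"
  where "oriented_unit_normal M p v \<longleftrightarrow>
    v \<in> E_perp M p \<and> norm v = 1 \<and> 0 \<le> mean_curvature M p \<bullet> v"

end

theory Submission
  imports Defs
begin

text \<open>
  Write \<open>\<phi>\<close> for the chart at \<open>p\<close>, \<open>D\<close> for its derivative and \<open>B\<close> for its second derivative at the
  base point, and \<open>N\<close> for the normal space. Differentiating \<open>\<lambda>x. (\<phi> x - a) \<bullet> (\<phi> x - a)\<close> once shows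
  that \<open>p\<close> is a singular point of the distance-squared function from \<open>a\<close> exactly if \<open>a - p \<in> N\<close>;
  differentiating twice, the Hessian at \<open>p\<close> is
  \<open>2 * (D \<xi> \<bullet> D \<eta> - (a - p) \<bullet> B \<xi> \<eta>)\<close>. Corank 3 means that this form vanishes, and since
  \<open>a - p\<close> is normal only the normal part of \<open>B\<close>, the second fundamental form, counts. By
  polarization it suffices to test unit tangent vectors on the diagonal. So \<open>a\<close> is an umbilical
  focus exactly if \<open>a - p \<in> N\<close> and \<open>(a - p) \<bullet> c = 1\<close> for all \<open>c\<close> in the curvature locus
  (\<open>umbilical_focus_iff\<close>).

  Rank 3 and polarization make the curvature locus span \<open>N\<close> (\<open>span_locus\<close>), so these linear
  equations have at most one solution. If the directions of the affine hull form a plane \<open>E\<close>, the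
  unit normal \<open>v\<close> of \<open>E\<close> in \<open>N\<close> has a constant product \<open>h\<close> with the locus. Here \<open>h\<close> is non-zero
  because the locus spans \<open>N\<close>, \<open>\<bar>h\<bar>\<close> is the distance of the affine hull from the origin
  (\<open>affine_hull_height\<close>), and \<open>h\<close> is the product of \<open>v\<close> with the mean curvature vector, which is
  an average of three points of the locus. The orientation of \<open>v\<close> makes \<open>h\<close> equal to the umbilic
  curvature, and \<open>(1 / h) *\<^sub>R v\<close> solves the equations.

  Polarization needs \<open>B\<close> to be symmetric, which is the content of \<open>dir_deriv_commute\<close>.
\<close>

section \<open>Symmetry of second derivatives\<close>

text \<open>Two applications of the mean value theorem, along \<open>u\<close> and then along \<open>v\<close>, to the second
  difference.\<close>
lemma second_difference_quotient_tendsto: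
  fixes g gu guv :: "'a::real_normed_vector \<Rightarrow> real"
  assumes "open U" "x \<in> U"
    and gu: "\<And>y. y \<in> U \<Longrightarrow> ((\<lambda>t. g (y + t *\<^sub>R u)) has_real_derivative gu y) (at 0)"
    and guv: "\<And>y. y \<in> U \<Longrightarrow> ((\<lambda>t. gu (y + t *\<^sub>R v)) has_real_derivative guv y) (at 0)"
    and cont: "isCont guv x"
  shows "((\<lambda>s. (g (x + s *\<^sub>R u + s *\<^sub>R v) - g (x + s *\<^sub>R u) - g (x + s *\<^sub>R v) + g x) / s\<^sup>2)
    \<longlongrightarrow> guv x) (at_right 0)"
proof (rule tendstoI)
  fix e :: real assume "0 < e"
  from cont \<open>0 < e\<close> obtain d1 where d1: "d1 > 0" "\<And>y. dist y x < d1 \<Longrightarrow> dist (guv y) (guv x) < e"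
    unfolding continuous_at_eps_delta by blast
  obtain d2 where d2: "d2 > 0" "ball x d2 \<subseteq> U"
    using \<open>open U\<close> \<open>x \<in> U\<close> open_contains_ball by blast
  \<comment> \<open>Below \<open>d\<close> the whole parallelogram spanned by \<open>s *\<^sub>R u\<close> and \<open>s *\<^sub>R v\<close> at \<open>x\<close> is admissible; the
    summand 1 only keeps the denominator positive.\<close>
  define d where "d = min d1 d2 / (norm u + norm v + 1)"
  have nn: "norm u + norm v + 1 > 0"
    by (smt (verit) norm_ge_zero)
  have "d > 0"
    using d1 d2 nn by (simp add: d_def)
  have near: "dist (x + r *\<^sub>R u + r' *\<^sub>R v) x < min d1 d2"
    if "0 \<le> r" "r \<le> s" "0 \<le> r'" "r' \<le> s" "0 < s" "s < d" for r r' s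
  proof -
    have "dist (x + r *\<^sub>R u + r' *\<^sub>R v) x \<le> norm (r *\<^sub>R u) + norm (r' *\<^sub>R v)"
      by (simp add: dist_norm add.assoc norm_triangle_ineq del: norm_scaleR)
    also have "\<dots> \<le> s * norm u + s * norm v"
      using that by (auto intro!: add_mono mult_right_mono)
    also have "\<dots> \<le> s * (norm u + norm v + 1)"
      using that by (simp add: algebra_simps)
    also have "\<dots> < d * (norm u + norm v + 1)"
      using that nn by (simp add: mult_strict_right_mono)
    also have "\<dots> = min d1 d2"
      using nn by (simp add: d_def)
    finally show ?thesis .
  qed
  have inU: "x + r *\<^sub>R u + r' *\<^sub>R v \<in> U"
    if "0 \<le> r" "r \<le> s" "0 \<le> r'" "r' \<le> s" "0 < s" "s < d" for r r' s
    using near[OF that] d2(2) by (auto simp: dist_commute)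
  have Du: "((\<lambda>t. g (z + t *\<^sub>R u)) has_real_derivative gu (z + r *\<^sub>R u)) (at r)"
    if "z + r *\<^sub>R u \<in> U" for z r
  proof -
    have "((\<lambda>t. g (z + (r + t) *\<^sub>R u)) has_real_derivative gu (z + r *\<^sub>R u)) (at 0)"
      using gu[OF that] by (simp add: algebra_simps)
    then show ?thesis
      using DERIV_at_within_shift[of "\<lambda>t. g (z + t *\<^sub>R u)" _ r 0 UNIV]
      by (simp add: o_def surj_plus)
  qed
  have Dv: "((\<lambda>t. gu (z + t *\<^sub>R v)) has_real_derivative guv (z + r *\<^sub>R v)) (at r)"
    if "z + r *\<^sub>R v \<in> U" for z r
  proof -
    have "((\<lambda>t. gu (z + (r + t) *\<^sub>R v)) has_real_derivative guv (z + r *\<^sub>R v)) (at 0)"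
      using guv[OF that] by (simp add: algebra_simps)
    then show ?thesis
      using DERIV_at_within_shift[of "\<lambda>t. gu (z + t *\<^sub>R v)" _ r 0 UNIV]
      by (simp add: o_def surj_plus)
  qed
  have "dist ((g (x + s *\<^sub>R u + s *\<^sub>R v) - g (x + s *\<^sub>R u) - g (x + s *\<^sub>R v) + g x) / s\<^sup>2) (guv x) < e"
    if s: "0 < s" "s < d" for s
  proof -
    let ?h = "\<lambda>r. g (x + s *\<^sub>R v + r *\<^sub>R u) - g (x + r *\<^sub>R u)"
    have "\<exists>r. 0 < r \<and> r < s \<and>
        ?h s - ?h 0 = (s - 0) * (gu (x + s *\<^sub>R v + r *\<^sub>R u) - gu (x + r *\<^sub>R u))"
    proof (rule MVT2[OF \<open>0 < s\<close>])
      fix r assume r: "0 \<le> r" "r \<le> s"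
      show "DERIV ?h r :> gu (x + s *\<^sub>R v + r *\<^sub>R u) - gu (x + r *\<^sub>R u)"
        using inU[of r s s] inU[of r s 0] r s
        by (intro DERIV_diff Du) (auto simp: algebra_simps)
    qed
    then obtain r where r: "0 < r" "r < s"
      and hr: "?h s - ?h 0 = s * (gu (x + s *\<^sub>R v + r *\<^sub>R u) - gu (x + r *\<^sub>R u))"
      by auto
    have "\<exists>r'. 0 < r' \<and> r' < s \<and>
        gu (x + r *\<^sub>R u + s *\<^sub>R v) - gu (x + r *\<^sub>R u + 0 *\<^sub>R v)
          = (s - 0) * guv (x + r *\<^sub>R u + r' *\<^sub>R v)"
      using inU[of r s] r s by (intro MVT2[OF \<open>0 < s\<close>] Dv) auto
    then obtain r' where r': "0 < r'" "r' < s"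
      and "gu (x + r *\<^sub>R u + s *\<^sub>R v) - gu (x + r *\<^sub>R u) = s * guv (x + r *\<^sub>R u + r' *\<^sub>R v)"
      by auto
    with hr have "?h s - ?h 0 = s\<^sup>2 * guv (x + r *\<^sub>R u + r' *\<^sub>R v)"
      by (simp add: power2_eq_square add_ac)
    then have "(g (x + s *\<^sub>R u + s *\<^sub>R v) - g (x + s *\<^sub>R u) - g (x + s *\<^sub>R v) + g x) / s\<^sup>2
        = guv (x + r *\<^sub>R u + r' *\<^sub>R v)"
      using s by (simp add: field_simps add_ac)
    then show ?thesis
      using near[of r s r'] r r' s d1(2) by auto
  qed
  then show "\<forall>\<^sub>F s in at_right 0.
      dist ((g (x + s *\<^sub>R u + s *\<^sub>R v) - g (x + s *\<^sub>R u) - g (x + s *\<^sub>R v) + g x) / s\<^sup>2) (guv x) < e"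
    using \<open>d > 0\<close> unfolding eventually_at_right_field by blast
qed

lemma smooth_on_differentiable:
  assumes "smooth_on U f" "y \<in> U"
  shows "f differentiable at y" "dir_deriv f v differentiable at y"
  using assms(1)[unfolded smooth_on_def, rule_format, of "Suc (Suc 0)"] assms(2) by auto

lemma smooth_on_dir_deriv_continuous:
  assumes "smooth_on U f"
  shows "continuous_on U (dir_deriv (dir_deriv f v) w)"
  using assms[unfolded smooth_on_def, rule_format, of "Suc (Suc 0)"] by auto

lemma has_real_derivative_along_line:
  assumes "f differentiable at y"
  shows "((\<lambda>t. f (y + t *\<^sub>R u) \<bullet> c) has_real_derivative dir_deriv f u y \<bullet> c) (at 0)"
proof -
  interpret linear "frechet_derivative f (at y)"
    using assms by (rule linear_frechet_derivative)
  have "((\<lambda>t::real. y + t *\<^sub>R u) has_derivative (\<lambda>t. t *\<^sub>R u)) (at 0)"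
    by (auto intro!: derivative_eq_intros)
  moreover have "(f has_derivative frechet_derivative f (at y)) (at (y + 0 *\<^sub>R u))"
    using frechet_derivative_works[THEN iffD1, OF assms] by simp
  ultimately have "((\<lambda>t. f (y + t *\<^sub>R u)) has_derivative (\<lambda>t. frechet_derivative f (at y) (t *\<^sub>R u))) (at 0)"
    by (rule has_derivative_compose)
  then have "((\<lambda>t. f (y + t *\<^sub>R u) \<bullet> c) has_derivative (\<lambda>t. frechet_derivative f (at y) (t *\<^sub>R u) \<bullet> c)) (at 0)"
    by (rule has_derivative_inner_left)
  then show ?thesis
    by (simp add: has_field_derivative_def scale mult.commute[of _ "_ \<bullet> _"])
qed

text \<open>Both iterated derivatives are limits of the same second difference quotient, which is
  symmetric in the two directions. Pairing with a fixed vector reduces to real-valued functions.\<close>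
lemma dir_deriv_commute:
  fixes f :: "'a::real_normed_vector \<Rightarrow> 'b::real_inner"
  assumes "open U" "x \<in> U" "smooth_on U f"
  shows "dir_deriv (dir_deriv f u) v x = dir_deriv (dir_deriv f v) u x"
proof -
  have lim: "((\<lambda>s. (f (x + s *\<^sub>R u + s *\<^sub>R v) \<bullet> c - f (x + s *\<^sub>R u) \<bullet> c - f (x + s *\<^sub>R v) \<bullet> c + f x \<bullet> c) / s\<^sup>2)
    \<longlongrightarrow> dir_deriv (dir_deriv f u) v x \<bullet> c) (at_right 0)" for u v c
    using assms smooth_on_dir_deriv_continuous[OF assms(3), of u v]
    by (intro second_difference_quotient_tendsto[of U x "\<lambda>y. f y \<bullet> c" u "\<lambda>y. dir_deriv f u y \<bullet> c" v
          "\<lambda>y. dir_deriv (dir_deriv f u) v y \<bullet> c"] has_real_derivative_along_line)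
      (auto intro: smooth_on_differentiable continuous_intros simp: continuous_on_eq_continuous_at)
  have "dir_deriv (dir_deriv f u) v x \<bullet> c = dir_deriv (dir_deriv f v) u x \<bullet> c" for c
  proof (rule tendsto_unique[OF _ lim])
    show "((\<lambda>s. (f (x + s *\<^sub>R u + s *\<^sub>R v) \<bullet> c - f (x + s *\<^sub>R u) \<bullet> c - f (x + s *\<^sub>R v) \<bullet> c + f x \<bullet> c) / s\<^sup>2)
      \<longlongrightarrow> dir_deriv (dir_deriv f v) u x \<bullet> c) (at_right 0)"
      using lim[of v u c] by (simp add: algebra_simps)
  qed simp
  then show ?thesis
    using vector_eq_rdot by blast
qed


section \<open>Affine hulls missing the origin\<close>

text \<open>The affine hull lies in the hyperplane of \<open>span C\<close> orthogonal to \<open>v\<close> at the height \<open>h\<close>, and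
  fills it because of the dimension of \<open>L\<close>; hence its point nearest to the origin is \<open>h *\<^sub>R v\<close>.
  The height is non-zero because \<open>v\<close> cannot be orthogonal to a set that spans it.\<close>
lemma affine_hull_height:
  fixes C :: "'a::euclidean_space set"
  assumes "C \<noteq> {}" and L: "subspace L" "affine_parallel (affine hull C) L"
    and dim: "dim (span C) = dim L + 1"
    and v: "v \<in> span C" "v \<in> orthogonal_comp L" "norm v = 1"
  obtains h where "h \<noteq> 0" "\<And>c. c \<in> affine hull C \<Longrightarrow> v \<bullet> c = h"
    "infdist 0 (affine hull C) = \<bar>h\<bar>"
proof -
  obtain c0 where c0: "c0 \<in> C" using \<open>C \<noteq> {}\<close> by blast
  obtain a where a: "\<And>y. y \<in> affine hull C \<longleftrightarrow> a + y \<in> L"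
    using L(2) unfolding affine_parallel_expl by blast
  have Aff: "y \<in> affine hull C \<longleftrightarrow> y - c0 \<in> L" for y
  proof -
    have *: "a + c0 \<in> L" using a c0 hull_inc by metis
    have "a + y \<in> L \<longleftrightarrow> (a + c0) + (y - c0) \<in> L" by simp
    also have "\<dots> \<longleftrightarrow> y - c0 \<in> L"
      using * L(1) by (metis add_diff_cancel_left' subspace_add subspace_diff)
    finally show ?thesis using a by simp
  qed
  have vL: "v \<bullet> l = 0" if "l \<in> L" for l
    using v(2) that by (simp add: orthogonal_comp_def orthogonal_def inner_commute)
  define h where "h = v \<bullet> c0"
  have height: "v \<bullet> c = h" if "c \<in> affine hull C" for c
    using vL[of "c - c0"] that by (simp add: Aff h_def inner_diff_right)
  have "h \<noteq> 0"
  proof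
    assume "h = 0"
    then have "orthogonal v c" if "c \<in> C" for c
      using height hull_inc[OF that] by (simp add: orthogonal_def)
    then have "orthogonal v v"
      using v(1) orthogonal_to_span by blast
    then show False using v(3) by (simp add: orthogonal_self)
  qed
  have LC: "L \<subseteq> span C"
  proof
    fix l assume "l \<in> L"
    then have "c0 + l \<in> affine hull C" by (simp add: Aff)
    then have "c0 + l \<in> span C" using affine_hull_subset_span by blast
    then show "l \<in> span C" using c0 span_base span_add_eq by blast
  qed
  \<comment> \<open>\<open>L\<close> is the full orthogonal complement of \<open>v\<close> in \<open>span C\<close>, so the foot of the perpendicular
    from the origin lies in the affine hull.\<close>
  have "L = {y \<in> span C. \<forall>x \<in> span {v}. orthogonal x y}" (is "L = ?K")
  proof (rule subspace_dim_equal)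
    have "?K = span C \<inter> orthogonal_comp (span {v})"
      by (auto simp: orthogonal_comp_def)
    then show "subspace ?K"
      by (simp add: subspace_inter subspace_orthogonal_comp)
    show "L \<subseteq> ?K"
      using LC vL by (auto simp: span_singleton orthogonal_def)
    have "dim ?K + dim (span {v}) = dim (span C)"
      using v(1) by (intro dim_subspace_orthogonal_to_vectors) (auto simp: span_minimal)
    then show "dim ?K \<le> dim L"
      using dim v(3) by (auto split: if_splits)
  qed fact
  moreover have "h *\<^sub>R v - c0 \<in> ?K"
    using v c0 by (auto simp: span_singleton orthogonal_def h_def inner_diff_right span_base span_diff
        span_scale dot_square_norm)
  ultimately have foot: "h *\<^sub>R v \<in> affine hull C"
    by (simp add: Aff)
  have "infdist 0 (affine hull C) = \<bar>h\<bar>"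
  proof (rule antisym)
    show "infdist 0 (affine hull C) \<le> \<bar>h\<bar>"
      using infdist_le[OF foot, of 0] v(3) by simp
    have "\<bar>h\<bar> \<le> dist 0 c" if "c \<in> affine hull C" for c
      using height[OF that] Cauchy_Schwarz_ineq2[of v c] v(3) by simp
    then show "\<bar>h\<bar> \<le> infdist 0 (affine hull C)"
      using foot by (auto simp: infdist_def intro!: cINF_greatest)
  qed
  then show thesis
    using that \<open>h \<noteq> 0\<close> height by blast
qed


section \<open>The second fundamental form at a point\<close>

lemma local_param_chart_at:
  assumes "regular_3manifold M" "p \<in> M"
  shows "\<exists>U. local_param M p U (chart M p) (base_point M p)"
proof -
  obtain U \<phi> x where "local_param M p U \<phi> x"
    using assms unfolding regular_3manifold_def by blast
  then have "\<exists>z. case z of (\<phi>, x) \<Rightarrow> \<exists>U. local_param M p U \<phi> x"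
    by (intro exI[of _ "(\<phi>, x)"]) auto
  then have "case chart_at M p of (\<phi>, x) \<Rightarrow> \<exists>U. local_param M p U \<phi> x"
    unfolding chart_at_def by (rule someI_ex)
  then show ?thesis
    by (simp add: case_prod_unfold)
qed

lemma corank_eq_3_iff:
  fixes A :: "real^3^3"
  shows "corank A = 3 \<longleftrightarrow> A = 0"
  using rank_bound[of A] rank_eq_0[of A] by (auto simp: corank_def)

locale manifold_point =
  fixes M :: "(real^6) set" and p :: "real^6"
  assumes regular: "regular_3manifold M" and p_in: "p \<in> M"
begin

abbreviation "D \<equiv> chart_deriv M p"
abbreviation "T \<equiv> tangent_space M p"
abbreviation "N \<equiv> normal_space M p"
abbreviation "II \<equiv> second_ff M p"

definition chart_hess :: "real^3 \<Rightarrow> real^3 \<Rightarrow> real^6"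
  where "chart_hess \<xi> \<eta> = dir_deriv (dir_deriv (chart M p) \<eta>) \<xi> (base_point M p)"

text \<open>Any open neighbourhood of the base point on which the chart is smooth would do.\<close>
definition chart_dom :: "(real^3) set"
  where "chart_dom = (SOME U. local_param M p U (chart M p) (base_point M p))"

lemma chart_dom:
  shows open_chart_dom: "open chart_dom"
    and base_point_in: "base_point M p \<in> chart_dom"
    and chart_base_point: "chart M p (base_point M p) = p"
    and smooth_chart: "smooth_on chart_dom (chart M p)"
    and inj_D: "inj D"
  using someI_ex[OF local_param_chart_at[OF regular p_in]]
  by (auto simp: local_param_def chart_dom_def chart_deriv_def)

lemma linear_dir_deriv_chart: "y \<in> chart_dom \<Longrightarrow> linear (\<lambda>v. dir_deriv (chart M p) v y)"
  using smooth_on_differentiable(1)[OF smooth_chart] linear_frechet_derivative by blast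

lemma linear_D: "linear D"
  unfolding chart_deriv_def using linear_dir_deriv_chart[OF base_point_in] by simp

lemma has_derivative_dir_deriv_chart:
  "(dir_deriv (chart M p) \<eta> has_derivative (\<lambda>\<xi>. chart_hess \<xi> \<eta>)) (at (base_point M p))"
  using smooth_on_differentiable(2)[OF smooth_chart base_point_in]
  unfolding chart_hess_def by (simp add: frechet_derivative_works[symmetric])

lemma chart_hess_commute: "chart_hess \<xi> \<eta> = chart_hess \<eta> \<xi>"
  unfolding chart_hess_def by (rule dir_deriv_commute[OF open_chart_dom base_point_in smooth_chart])

lemma linear_chart_hess: "linear (\<lambda>\<xi>. chart_hess \<xi> \<eta>)"
  using has_derivative_dir_deriv_chart by (rule has_derivative_linear)

lemma linear_chart_hess_right: "linear (chart_hess \<xi>)"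
proof -
  have "chart_hess \<xi> = (\<lambda>\<eta>. chart_hess \<eta> \<xi>)"
    using chart_hess_commute by blast
  then show ?thesis using linear_chart_hess by simp
qed

lemma subspace_T: "subspace T"
  unfolding tangent_space_def using linear_D by (simp add: linear_subspace_image)

lemma subspace_N: "subspace N"
  unfolding normal_space_def by (rule subspace_orthogonal_comp)

lemma dim_T: "dim T = 3"
proof -
  have "dim (range D) = dim (UNIV :: (real^3) set)"
    using linear_D inj_D by (intro dim_image_eq) auto
  then show ?thesis
    by (simp add: tangent_space_def)
qed

lemma dim_N: "dim N = 3"
proof -
  have "dim {y \<in> UNIV. \<forall>x \<in> T. orthogonal x y} + dim T = dim (UNIV :: (real^6) set)"
    using subspace_T by (intro dim_subspace_orthogonal_to_vectors) auto
  then show ?thesis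
    using dim_T by (simp add: normal_space_def orthogonal_comp_def)
qed

lemma inner_normal_tangent: "n \<in> N \<Longrightarrow> t \<in> T \<Longrightarrow> n \<bullet> t = 0"
  by (auto simp: normal_space_def orthogonal_comp_def orthogonal_def inner_commute)

lemma normal_partI:
  assumes "n \<in> N" "z - n \<in> T"
  shows "normal_part M p z = n"
  unfolding normal_part_def
proof (rule the_equality)
  fix n' assume n': "n' \<in> N \<and> z - n' \<in> T"
  have "n' - n \<in> N"
    using n' assms subspace_N subspace_diff by blast
  moreover have "(z - n) - (z - n') \<in> T"
    using n' assms subspace_T subspace_diff by blast
  ultimately show "n' = n"
    using inner_normal_tangent[of "n' - n" "n' - n"] by simp
qed (use assms in simp)

lemma normal_part_works: "normal_part M p z \<in> N" "z - normal_part M p z \<in> T"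
proof -
  have "z \<in> T + N"
    using subspace_sum_orthogonal_comp[OF subspace_T] by (simp add: normal_space_def)
  then obtain t n where "t \<in> T" "n \<in> N" "z = t + n"
    by (rule set_plus_elim)
  then show "normal_part M p z \<in> N" "z - normal_part M p z \<in> T"
    using normal_partI[of n z] by auto
qed

lemma linear_normal_part: "linear (normal_part M p)"
proof
  fix y z
  have "(y - normal_part M p y) + (z - normal_part M p z) \<in> T"
    by (intro subspace_add[OF subspace_T] normal_part_works)
  then show "normal_part M p (y + z) = normal_part M p y + normal_part M p z"
    by (intro normal_partI subspace_add[OF subspace_N] normal_part_works) (simp add: algebra_simps)
next
  fix r z
  have "r *\<^sub>R (z - normal_part M p z) \<in> T"
    by (intro subspace_scale[OF subspace_T] normal_part_works)
  then show "normal_part M p (r *\<^sub>R z) = r *\<^sub>R normal_part M p z"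
    by (intro normal_partI subspace_scale[OF subspace_N] normal_part_works)
      (simp add: scaleR_diff_right)
qed

lemma inner_normal_part: "n \<in> N \<Longrightarrow> n \<bullet> normal_part M p z = n \<bullet> z"
  using inner_normal_tangent[of n "z - normal_part M p z"] normal_part_works(2)
  by (simp add: inner_diff_right)

lemma second_ff_chart: "II (D \<xi>) (D \<eta>) = normal_part M p (chart_hess \<xi> \<eta>)"
  unfolding second_ff_def chart_hess_def Let_def using inj_D by simp

text \<open>Through polarization and homogeneity the curvature locus, which sees only unit vectors on the
  diagonal, determines the whole second fundamental form.\<close>
lemma second_ff_polarization:
  assumes "u \<in> T" "w \<in> T"
  shows "II u w = (1/2) *\<^sub>R (II (u + w) (u + w) - II u u - II w w)"
proof -
  obtain \<xi> \<eta> where [simp]: "u = D \<xi>" "w = D \<eta>"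
    using assms by (auto simp: tangent_space_def)
  have sum: "u + w = D (\<xi> + \<eta>)"
    using linear_D by (simp add: linear_add)
  have "chart_hess (\<xi> + \<eta>) (\<xi> + \<eta>) = chart_hess \<xi> \<xi> + 2 *\<^sub>R chart_hess \<xi> \<eta> + chart_hess \<eta> \<eta>"
    using linear_add[OF linear_chart_hess] linear_add[OF linear_chart_hess_right]
      chart_hess_commute[of \<eta> \<xi>] by (simp add: scaleR_2 algebra_simps)
  then show ?thesis
    unfolding sum
    by (simp add: second_ff_chart linear_add[OF linear_normal_part] linear_cmul[OF linear_normal_part])
qed

lemma second_ff_scaleR:
  assumes "w \<in> T"
  shows "II (r *\<^sub>R w) (r *\<^sub>R w) = r\<^sup>2 *\<^sub>R II w w"
proof -
  obtain \<xi> where [simp]: "w = D \<xi>"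
    using assms by (auto simp: tangent_space_def)
  have sc: "r *\<^sub>R w = D (r *\<^sub>R \<xi>)"
    using linear_D by (simp add: linear_cmul)
  show ?thesis
    unfolding sc
    by (simp add: second_ff_chart linear_cmul[OF linear_chart_hess] linear_cmul[OF linear_chart_hess_right]
        linear_cmul[OF linear_normal_part] power2_eq_square)
qed

lemma second_ff_normalize:
  assumes "w \<in> T" "w \<noteq> 0"
  obtains c where "c \<in> curvature_locus M p" "II w w = (norm w)\<^sup>2 *\<^sub>R c"
proof
  let ?w = "w /\<^sub>R norm w"
  have wT: "?w \<in> T"
    using assms(1) subspace_T by (simp add: subspace_scale)
  then show "II ?w ?w \<in> curvature_locus M p"
    using assms(2) unfolding curvature_locus_def by fastforce
  show "II w w = (norm w)\<^sup>2 *\<^sub>R II ?w ?w"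
    using second_ff_scaleR[OF wT, of "norm w"] assms(2) by simp
qed

lemma second_ff_zero: "II 0 0 = 0"
  using second_ff_scaleR[of 0 0] subspace_T subspace_0 by auto

lemma curvature_locus_subset_N: "curvature_locus M p \<subseteq> N"
  by (auto simp: curvature_locus_def tangent_space_def second_ff_chart normal_part_works)

lemma second_ff_in_span_locus:
  assumes "u \<in> T" "w \<in> T"
  shows "II u w \<in> span (curvature_locus M p)"
proof -
  have diag: "II w w \<in> span (curvature_locus M p)" if "w \<in> T" for w
  proof (cases "w = 0")
    case False
    with that obtain k where "k \<in> curvature_locus M p" "II w w = (norm w)\<^sup>2 *\<^sub>R k"
      by (rule second_ff_normalize)
    then show ?thesis
      by (simp add: span_base span_scale)
  qed (simp add: second_ff_zero span_zero)
  have "u + w \<in> T"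
    using assms subspace_T subspace_add by blast
  then show ?thesis
    unfolding second_ff_polarization[OF assms]
    using diag assms by (intro span_scale span_diff) auto
qed

text \<open>By polarization the span of the locus contains all values of the second fundamental form, so
  its dimension is at least the rank, which is the dimension of the normal space.\<close>
lemma span_locus:
  assumes "second_ff_rank M p = 3"
  shows "span (curvature_locus M p) = N"
proof (rule subspace_dim_equal)
  show "span (curvature_locus M p) \<subseteq> N"
    using curvature_locus_subset_N subspace_N by (rule span_minimal)
  have "{II u w | u w. u \<in> T \<and> w \<in> T} \<subseteq> span (curvature_locus M p)"
    using second_ff_in_span_locus by auto
  then have "span {II u w | u w. u \<in> T \<and> w \<in> T} \<subseteq> span (curvature_locus M p)"
    by (rule span_minimal) simp
  then have "3 \<le> dim (span (curvature_locus M p))"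
    unfolding assms[unfolded second_ff_rank_def, symmetric] by (rule dim_subset)
  then show "dim N \<le> dim (span (curvature_locus M p))"
    using dim_N by simp
qed (simp_all add: subspace_N)

lemma orthonormal_basis_of_tangent_space:
  assumes "orthonormal_basis_of B T"
  shows "finite B" "card B = 3" "B \<subseteq> T"
proof -
  have B: "pairwise orthogonal B" "\<And>b. b \<in> B \<Longrightarrow> norm b = 1" "span B = T"
    using assms by (auto simp: orthonormal_basis_of_def)
  then have "independent B"
    by (metis norm_zero pairwise_orthogonal_independent zero_neq_one)
  then show "finite B" "card B = 3" "B \<subseteq> T"
    using B dim_T independent_imp_finite dim_span_eq_card_independent span_superset by metis+
qed

lemma ex_orthonormal_basis_of_tangent_space: "\<exists>B. orthonormal_basis_of B T"
  using orthonormal_basis_subspace[OF subspace_T] unfolding orthonormal_basis_of_def by metis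

lemma curvature_locus_nonempty: "curvature_locus M p \<noteq> {}"
proof -
  obtain B where B: "orthonormal_basis_of B T"
    using ex_orthonormal_basis_of_tangent_space by blast
  then obtain b where "b \<in> B"
    using orthonormal_basis_of_tangent_space(2)[OF B] by fastforce
  then show ?thesis
    using B orthonormal_basis_of_tangent_space(3)[OF B]
    by (auto simp: curvature_locus_def orthonormal_basis_of_def)
qed

text \<open>The mean curvature vector is the average of the locus points belonging to three orthonormal
  directions, so a linear functional that is constant on the locus takes the same value there.\<close>
lemma mean_curvature_height:
  assumes "\<And>c. c \<in> curvature_locus M p \<Longrightarrow> v \<bullet> c = h"
  shows "mean_curvature M p \<bullet> v = h"
proof -
  define B where "B = (SOME B. orthonormal_basis_of B T)"
  have B: "orthonormal_basis_of B T"
    unfolding B_def using ex_orthonormal_basis_of_tangent_space by (rule someI_ex)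
  have "II b b \<in> curvature_locus M p" if "b \<in> B" for b
    using that B orthonormal_basis_of_tangent_space(3)[OF B]
    by (auto simp: curvature_locus_def orthonormal_basis_of_def)
  then have "(\<Sum>b\<in>B. v \<bullet> II b b) = (\<Sum>b\<in>B. h)"
    by (intro sum.cong) (auto simp: assms)
  also have "\<dots> = 3 * h"
    using orthonormal_basis_of_tangent_space(2)[OF B] by simp
  finally have "v \<bullet> (\<Sum>b\<in>B. II b b) = 3 * h"
    by (simp add: inner_sum_right)
  then show ?thesis
    by (simp add: mean_curvature_def B_def Let_def inner_commute)
qed


section \<open>Umbilical foci\<close>

lemma has_derivative_dist_sq_chart:
  assumes "y \<in> chart_dom"
  shows "(dist_sq a \<circ> chart M p has_derivative
    (\<lambda>\<xi>. 2 * ((chart M p y - a) \<bullet> dir_deriv (chart M p) \<xi> y))) (at y)"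
proof -
  have "(chart M p has_derivative (\<lambda>\<xi>. dir_deriv (chart M p) \<xi> y)) (at y)"
    using smooth_on_differentiable(1)[OF smooth_chart assms] by (simp add: frechet_derivative_works[symmetric])
  then have "((\<lambda>y. (chart M p y - a) \<bullet> (chart M p y - a)) has_derivative
      (\<lambda>\<xi>. 2 * ((chart M p y - a) \<bullet> dir_deriv (chart M p) \<xi> y))) (at y)"
    by (auto intro!: derivative_eq_intros simp: inner_commute)
  moreover have "dist_sq a \<circ> chart M p = (\<lambda>y. (chart M p y - a) \<bullet> (chart M p y - a))"
    by (auto simp: dist_sq_def dot_square_norm)
  ultimately show ?thesis by simp
qed

lemma dir_deriv_dist_sq_chart:
  assumes "y \<in> chart_dom"
  shows "dir_deriv (dist_sq a \<circ> chart M p) \<eta> y = 2 * ((chart M p y - a) \<bullet> dir_deriv (chart M p) \<eta> y)"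
  using frechet_derivative_at[OF has_derivative_dist_sq_chart[OF assms, of a]] by metis

lemma dir_deriv2_dist_sq_chart:
  "dir_deriv (dir_deriv (dist_sq a \<circ> chart M p) \<eta>) \<xi> (base_point M p)
    = 2 * (D \<xi> \<bullet> D \<eta> - (a - p) \<bullet> chart_hess \<xi> \<eta>)"
proof -
  have "(chart M p has_derivative D) (at (base_point M p))"
    using smooth_on_differentiable(1)[OF smooth_chart base_point_in]
    by (simp add: chart_deriv_def frechet_derivative_works[symmetric])
  then have "((\<lambda>y. 2 * ((chart M p y - a) \<bullet> dir_deriv (chart M p) \<eta> y)) has_derivative
      (\<lambda>\<xi>. 2 * (D \<xi> \<bullet> D \<eta> - (a - p) \<bullet> chart_hess \<xi> \<eta>))) (at (base_point M p))"
    using has_derivative_dir_deriv_chart[of \<eta>]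
    by (auto intro!: derivative_eq_intros
        simp: chart_base_point chart_deriv_def inner_diff_left algebra_simps)
  then have "(dir_deriv (dist_sq a \<circ> chart M p) \<eta> has_derivative
      (\<lambda>\<xi>. 2 * (D \<xi> \<bullet> D \<eta> - (a - p) \<bullet> chart_hess \<xi> \<eta>))) (at (base_point M p))"
    by (rule has_derivative_transform_within_open[OF _ open_chart_dom base_point_in])
      (simp add: dir_deriv_dist_sq_chart)
  from frechet_derivative_at[OF this] show ?thesis by metis
qed

lemma singular_dist_sq_iff: "is_singular_at M (dist_sq a) p \<longleftrightarrow> a - p \<in> N"
proof -
  have "is_singular_at M (dist_sq a) p \<longleftrightarrow> (\<forall>\<xi>. (p - a) \<bullet> D \<xi> = 0)"
    by (simp add: is_singular_at_def dir_deriv_dist_sq_chart[OF base_point_in] chart_base_point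
        chart_deriv_def)
  also have "\<dots> \<longleftrightarrow> a - p \<in> N"
    by (auto simp: normal_space_def orthogonal_comp_def orthogonal_def tangent_space_def
        inner_diff_right inner_diff_left inner_commute)
  finally show ?thesis .
qed

text \<open>The Hessian matrix records a bilinear form on the standard basis; it vanishes together with
  the form.\<close>
lemma hess_dist_sq_eq_0_iff:
  "hess_on M (dist_sq a) p = 0 \<longleftrightarrow> (\<forall>\<xi> \<eta>. (a - p) \<bullet> chart_hess \<xi> \<eta> = D \<xi> \<bullet> D \<eta>)"
proof -
  let ?q = "\<lambda>\<xi> \<eta>. D \<xi> \<bullet> D \<eta> - (a - p) \<bullet> chart_hess \<xi> \<eta>"
  have "hess_on M (dist_sq a) p = 0 \<longleftrightarrow> (\<forall>i j. ?q (axis i 1) (axis j 1) = 0)"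
    unfolding hess_on_def hessian_def dir_deriv2_dist_sq_chart by (simp add: vec_eq_iff)
  also have "\<dots> \<longleftrightarrow> (\<forall>\<xi> \<eta>. ?q \<xi> \<eta> = 0)"
  proof (intro iffI allI)
    fix \<xi> \<eta> assume basis: "\<forall>i j. ?q (axis i 1) (axis j 1) = 0"
    have lin: "linear (\<lambda>\<xi>. ?q \<xi> \<eta>)" "linear (?q \<xi>)" for \<xi> \<eta>
      by (intro linearI; simp add: linear_add[OF linear_D] linear_cmul[OF linear_D]
          linear_add[OF linear_chart_hess] linear_cmul[OF linear_chart_hess]
          linear_add[OF linear_chart_hess_right] linear_cmul[OF linear_chart_hess_right]
          algebra_simps)+
    have "?q (axis i 1) = (\<lambda>_. 0)" for i
      using basis by (intro linear_eq_stdbasis[OF lin(2) linear_zero]) (auto simp: Basis_vec_def)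
    then have "?q (axis i 1) \<eta> = 0" for i
      by metis
    then have "(\<lambda>\<xi>. ?q \<xi> \<eta>) = (\<lambda>_. 0)"
      by (intro linear_eq_stdbasis[OF lin(1) linear_zero]) (auto simp: Basis_vec_def)
    then show "?q \<xi> \<eta> = 0"
      by metis
  qed auto
  finally show ?thesis by (metis eq_iff_diff_eq_0)
qed

text \<open>A vanishing Hessian says that \<open>(a - p) \<bullet> II u w = u \<bullet> w\<close> on tangent vectors. Both sides are
  symmetric bilinear forms, so they agree as soon as they agree on the unit sphere, where the right
  side is 1. The condition becomes a system of affine equations for \<open>a\<close>.\<close>
lemma umbilical_focus_iff:
  "umbilical_focus M p a \<longleftrightarrow> a - p \<in> N \<and> (\<forall>c \<in> curvature_locus M p. (a - p) \<bullet> c = 1)"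
proof -
  have "umbilical_focus M p a \<longleftrightarrow> a - p \<in> N \<and> hess_on M (dist_sq a) p = 0"
    by (auto simp: umbilical_focus_def focal_set_def singular_dist_sq_iff corank_eq_3_iff
        det_0[where ?'a = real, simplified])
  also have "\<dots> \<longleftrightarrow> a - p \<in> N \<and> (\<forall>\<xi> \<eta>. (a - p) \<bullet> II (D \<xi>) (D \<eta>) = D \<xi> \<bullet> D \<eta>)"
    unfolding hess_dist_sq_eq_0_iff second_ff_chart by (auto simp: inner_normal_part)
  also have "\<dots> \<longleftrightarrow> a - p \<in> N \<and> (\<forall>u\<in>T. \<forall>w\<in>T. (a - p) \<bullet> II u w = u \<bullet> w)"
    by (auto simp: tangent_space_def)
  also have "\<dots> \<longleftrightarrow> a - p \<in> N \<and> (\<forall>c \<in> curvature_locus M p. (a - p) \<bullet> c = 1)"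
  proof (intro conj_cong iffI ballI refl)
    fix c assume "\<forall>u\<in>T. \<forall>w\<in>T. (a - p) \<bullet> II u w = u \<bullet> w" "c \<in> curvature_locus M p"
    then show "(a - p) \<bullet> c = 1"
      by (auto simp: curvature_locus_def norm_eq_1)
  next
    fix u w assume c: "\<forall>c \<in> curvature_locus M p. (a - p) \<bullet> c = 1" and uw: "u \<in> T" "w \<in> T"
    have diag: "(a - p) \<bullet> II w w = w \<bullet> w" if "w \<in> T" for w
    proof (cases "w = 0")
      case False
      with that obtain k where "k \<in> curvature_locus M p" "II w w = (norm w)\<^sup>2 *\<^sub>R k"
        by (rule second_ff_normalize)
      then show ?thesis
        using c by (simp add: dot_square_norm)
    qed (simp add: second_ff_zero)
    have "u + w \<in> T"
      using uw subspace_T subspace_add by blast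
    then show "(a - p) \<bullet> II u w = u \<bullet> w"
      unfolding second_ff_polarization[OF uw] inner_scaleR_right
        inner_diff_right diag[OF uw(1)] diag[OF uw(2)]
      by (simp add: diag inner_add_left inner_add_right inner_commute[of w u])
  qed
  finally show ?thesis .
qed

lemma E_space_parallel: "subspace (E_space M p)" "affine_parallel (Aff M p) (E_space M p)"
proof -
  have "\<exists>!L. subspace L \<and> affine_parallel (Aff M p) L"
    using curvature_locus_nonempty by (intro affine_parallel_subspace) (auto simp: Aff_def)
  from theI'[OF this] show "subspace (E_space M p)" "affine_parallel (Aff M p) (E_space M p)"
    unfolding E_space_def by auto
qed

text \<open>One number \<open>h\<close> is at once the height of the locus over \<open>E\<close>, the product of the mean curvature
  vector with \<open>v\<close> and, up to sign, the umbilic curvature.\<close>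
lemma E_perp_height:
  assumes "second_ff_rank M p = 3" "dim (E_space M p) = 2"
    and "v \<in> E_perp M p" "norm v = 1"
  obtains h where "h \<noteq> 0" "\<And>c. c \<in> curvature_locus M p \<Longrightarrow> v \<bullet> c = h"
    "mean_curvature M p \<bullet> v = h" "umbilic_curvature M p = \<bar>h\<bar>"
proof -
  have "dim (span (curvature_locus M p)) = dim (E_space M p) + 1"
    using span_locus[OF assms(1)] dim_N assms(2) by simp
  moreover have "v \<in> span (curvature_locus M p)" "v \<in> orthogonal_comp (E_space M p)"
    using assms(3) span_locus[OF assms(1)] by (auto simp: E_perp_def)
  ultimately obtain h where h: "h \<noteq> 0" "\<And>c. c \<in> Aff M p \<Longrightarrow> v \<bullet> c = h"
      "infdist 0 (Aff M p) = \<bar>h\<bar>"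
    unfolding Aff_def
    by (rule affine_hull_height[OF curvature_locus_nonempty E_space_parallel[unfolded Aff_def]
          _ _ _ assms(4)]) blast
  have height: "v \<bullet> c = h" if "c \<in> curvature_locus M p" for c
    using h(2) that by (simp add: Aff_def hull_inc)
  show thesis
    using h(3) by (intro that[of h] \<open>h \<noteq> 0\<close> height mean_curvature_height)
      (simp_all add: umbilic_curvature_def)
qed

lemma E_space_subset_N: "E_space M p \<subseteq> N"
proof
  have Aff_N: "Aff M p \<subseteq> N"
    unfolding Aff_def using curvature_locus_subset_N subspace_imp_affine[OF subspace_N]
    by (rule hull_minimal)
  obtain a where a: "E_space M p = (\<lambda>x. a + x) ` Aff M p"
    using E_space_parallel(2) unfolding affine_parallel_def by blast
  fix e assume "e \<in> E_space M p"
  then obtain y where y: "y \<in> Aff M p" "e = a + y"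
    using a by auto
  have "0 \<in> E_space M p"
    using E_space_parallel(1) by (rule subspace_0)
  then obtain z where z: "z \<in> Aff M p" "0 = a + z"
    using a by auto
  have "e = y - z"
    using y(2) z(2) by (simp add: eq_neg_iff_add_eq_0)
  then show "e \<in> N"
    using y(1) z(1) Aff_N subspace_diff[OF subspace_N] by auto
qed

lemma ex_unit_E_perp:
  assumes "dim (E_space M p) = 2"
  obtains v where "v \<in> E_perp M p" "norm v = 1"
proof -
  have "E_space M p \<noteq> N"
    using assms dim_N by auto
  then have "span (E_space M p) \<subset> span N"
    unfolding span_eq_iff[THEN iffD2, OF E_space_parallel(1)] span_eq_iff[THEN iffD2, OF subspace_N]
    using E_space_subset_N by blast
  then obtain w where "w \<noteq> 0" "w \<in> span N"
    "\<And>y. y \<in> span (E_space M p) \<Longrightarrow> orthogonal w y"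
    using orthogonal_to_subspace_exists_gen[of "E_space M p" N] by blast
  then have "w \<in> N \<and> w \<noteq> 0 \<and> w \<in> orthogonal_comp (E_space M p)"
    unfolding span_eq_iff[THEN iffD2, OF subspace_N]
    by (auto simp: orthogonal_comp_def orthogonal_commute span_base)
  then obtain w where w: "w \<in> N" "w \<noteq> 0" "w \<in> orthogonal_comp (E_space M p)" by blast
  show thesis
  proof
    show "w /\<^sub>R norm w \<in> E_perp M p"
      using w subspace_N by (auto simp: E_perp_def intro!: subspace_scale subspace_orthogonal_comp)
    show "norm (w /\<^sub>R norm w) = 1"
      using w(2) by simp
  qed
qed

end

theorem proposition6p6:
  fixes M :: "(real^6) set" and p :: "real^6"
  assumes "regular_3manifold M"
    and "\<forall>q\<in>M. second_ff_rank M q = 3"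
    and "p \<in> M"
    and "dim (E_space M p) = 2"
  shows "umbilic_curvature M p \<noteq> 0 \<and>
    (\<exists>!a. umbilical_focus M p a) \<and>
    (\<exists>v. oriented_unit_normal M p v) \<and>
    (\<forall>v. oriented_unit_normal M p v \<longrightarrow>
       umbilical_focus M p (p + (1 / umbilic_curvature M p) *\<^sub>R v))"
proof -
  interpret manifold_point M p
    using assms(1,3) by unfold_locales
  have rank: "second_ff_rank M p = 3"
    using assms(2,3) by blast
  note height = E_perp_height[OF rank assms(4)]
  obtain v0 where v0: "v0 \<in> E_perp M p" "norm v0 = 1"
    using ex_unit_E_perp[OF assms(4)] .
  \<comment> \<open>One of \<open>v0\<close> and \<open>- v0\<close> has the right orientation.\<close>
  have ex: "\<exists>v. oriented_unit_normal M p v"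
  proof (cases "0 \<le> mean_curvature M p \<bullet> v0")
    case False
    have "- v0 \<in> E_perp M p"
      using v0(1) subspace_N subspace_orthogonal_comp unfolding E_perp_def by (blast intro: subspace_neg)
    then have "oriented_unit_normal M p (- v0)"
      using v0 False by (simp add: oriented_unit_normal_def)
    then show ?thesis ..
  qed (use v0 in \<open>auto simp: oriented_unit_normal_def\<close>)
  have focus: "umbilical_focus M p (p + (1 / umbilic_curvature M p) *\<^sub>R v)"
    if "oriented_unit_normal M p v" for v
  proof -
    have v: "v \<in> E_perp M p" "norm v = 1" "0 \<le> mean_curvature M p \<bullet> v"
      using that by (auto simp: oriented_unit_normal_def)
    obtain h where h: "h \<noteq> 0" "\<And>c. c \<in> curvature_locus M p \<Longrightarrow> v \<bullet> c = h"
      "mean_curvature M p \<bullet> v = h" "umbilic_curvature M p = \<bar>h\<bar>"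
      using height[OF v(1,2)] by metis
    then show ?thesis
      using v subspace_N by (auto simp: umbilical_focus_iff E_perp_def intro: subspace_scale)
  qed
  \<comment> \<open>The difference of two umbilical foci is a normal vector orthogonal to the locus, which spans
    the normal space.\<close>
  have unique: "a = b" if "umbilical_focus M p a" "umbilical_focus M p b" for a b
  proof -
    have N: "a - b \<in> N"
      using that subspace_diff[OF subspace_N, of "a - p" "b - p"] by (simp add: umbilical_focus_iff)
    have "orthogonal (a - b) c" if "c \<in> curvature_locus M p" for c
    proof -
      have "(a - p) \<bullet> c = (b - p) \<bullet> c"
        using \<open>umbilical_focus M p a\<close> \<open>umbilical_focus M p b\<close> that
        by (simp add: umbilical_focus_iff)
      then show ?thesis
        by (simp add: orthogonal_def inner_diff_left)
    qed
    then have "orthogonal (a - b) (a - b)"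
      using N span_locus[OF rank] orthogonal_to_span by blast
    then show ?thesis
      by (simp add: orthogonal_self)
  qed
  have "umbilic_curvature M p \<noteq> 0"
    using height[OF v0] by (metis abs_eq_0_iff)
  then show ?thesis
    using ex focus unique by blast
qed

end
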